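(* There is a positive constant $\gamma$ such that for every integer $t \geq 30$ and every integer $m \leq \gamma 2^t$, every $(m,m,m,m)$-cube $A$ of order $n=2^t$ is avoidable.
   Context: A cube of order $n$ is an $n\times n\times n$ array of cells $(i,j,k)$, $i,j,k\in[n]=\{1,\dots,n\}$. A line of a cube is obtained by fixing two coordinates and letting the third vary: a row is $\{(i,j^*,k): j^*\in[n]\}$, a column is $\{(i^*,j,k): i^*\in[n]\}$, a file is $\{(i,j,k^* ):k^*\in[n]\}$. An $(m,m,m,m)$-cube of order $n$ is a cube $A$ of order $n$ in which each cell $(i,j,k)$ contains a subset $A(i,j,k)\subseteq[n]$ such that: every cell contains at most $m$ symbols, and each symbol occurs at most $m$ times in each row, at most $m$ times in each column, and at most $m$ times in each file. A Latin cube $L$ of order $n$ is a cube of order $n$ whose every cell contains one symbol $L(i,j,k)\in[n]$ such that each symbol appears exactly once in each row, column and file. $A$ is avoidable if there is a Latin cube $L$ of order $n$ with $L(i,j,k)\notin A(i,j,k)$ for all $i,j,k\in[n]$. *)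

theory Defs
  imports Complex_Main
begin

definition mcube :: "nat \<Rightarrow> nat \<Rightarrow> (nat \<Rightarrow> nat \<Rightarrow> nat \<Rightarrow> nat set) \<Rightarrow> bool" where
  "mcube m n A \<longleftrightarrow>
     (\<forall>i\<in>{1..n}. \<forall>j\<in>{1..n}. \<forall>k\<in>{1..n}. A i j k \<subseteq> {1..n} \<and> card (A i j k) \<le> m) \<and>
     (\<forall>s\<in>{1..n}. \<forall>i\<in>{1..n}. \<forall>k\<in>{1..n}. card {j\<in>{1..n}. s \<in> A i j k} \<le> m) \<and>
     (\<forall>s\<in>{1..n}. \<forall>j\<in>{1..n}. \<forall>k\<in>{1..n}. card {i\<in>{1..n}. s \<in> A i j k} \<le> m) \<and>
     (\<forall>s\<in>{1..n}. \<forall>i\<in>{1..n}. \<forall>j\<in>{1..n}. card {k\<in>{1..n}. s \<in> A i j k} \<le> m)"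

definition latin_cube :: "nat \<Rightarrow> (nat \<Rightarrow> nat \<Rightarrow> nat \<Rightarrow> nat) \<Rightarrow> bool" where
  "latin_cube n L \<longleftrightarrow>
     (\<forall>i\<in>{1..n}. \<forall>k\<in>{1..n}. bij_betw (\<lambda>j. L i j k) {1..n} {1..n}) \<and>
     (\<forall>j\<in>{1..n}. \<forall>k\<in>{1..n}. bij_betw (\<lambda>i. L i j k) {1..n} {1..n}) \<and>
     (\<forall>i\<in>{1..n}. \<forall>j\<in>{1..n}. bij_betw (\<lambda>k. L i j k) {1..n} {1..n})"

definition avoidable :: "nat \<Rightarrow> (nat \<Rightarrow> nat \<Rightarrow> nat \<Rightarrow> nat set) \<Rightarrow> bool" where
  "avoidable n A \<longleftrightarrow> (\<exists>L. latin_cube n L \<and>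
     (\<forall>i\<in>{1..n}. \<forall>j\<in>{1..n}. \<forall>k\<in>{1..n}. L i j k \<notin> A i j k))"

end

theory Submission
  imports Defs "HOL-Library.FuncSet"
begin

text \<open>
  Start from the Boolean Latin cube \<open>L(i, j, k) = i + j + k\<close> over the group \<open>G\<close> of order \<open>n = 2^t\<close> and
  exponent 2. For a cell \<open>x\<close> and \<open>a \<noteq> 0\<close> the eight cells \<open>x + a e\<close>, \<open>e \<in> {0,1}^3\<close>, form a Latin subcube
  of order 2 on the symbols \<open>s\<close>, \<open>s + a\<close>, which can be swapped; disjoint subcubes can be swapped
  simultaneously.

  Counting shows that suitable permutations of rows, columns and files make the forbidden entries
  sparse (at most \<open>r = n / 256\<close>) on every line of \<open>G^4\<close> in each nonzero 0-1 direction. After that,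
  each conflict cell \<open>x\<close> has at least \<open>n - 15 r\<close> directions \<open>a\<close> whose swap resolves the conflict without
  creating another one and whose subcube contains no further conflict cell, and a subcube
  \<open>(x, a)\<close> meets at most \<open>49 r\<close> of the subcubes \<open>(y, b)\<close> of the other conflict cells. As
  \<open>n - 15 r \<ge> 4 * 49 r\<close>, an independent transversal exists, i.e. the directions can be chosen such that
  the subcubes are pairwise disjoint; swapping all of them gives the Latin cube.
\<close>

unbundle bit_operations_syntax

section \<open>Independent transversals\<close>

text \<open>Extensional functions are used so that the transversals of a finite \<open>S\<close>
  with finite \<open>V x\<close> can be counted.\<close>

definition ind_transversals ::
  "('x \<Rightarrow> 'a set) \<Rightarrow> ('x \<Rightarrow> 'a \<Rightarrow> 'x \<Rightarrow> 'a \<Rightarrow> bool) \<Rightarrow> 'x set \<Rightarrow> ('x \<Rightarrow> 'a) set" where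
  "ind_transversals V adj S =
     {f \<in> Pi\<^sub>E S V. \<forall>x\<in>S. \<forall>y\<in>S. x \<noteq> y \<longrightarrow> \<not> adj x (f x) y (f y)}"

lemma finite_ind_transversals:
  assumes "finite S" "\<And>x. x \<in> S \<Longrightarrow> finite (V x)"
  shows "finite (ind_transversals V adj S)"
  unfolding ind_transversals_def
  by (rule finite_subset[OF _ finite_PiE[of S V]]) (use assms in auto)

text \<open>Forgetting the fixed value at \<open>y\<close> loses no information, so restriction to
  \<open>S - {y}\<close> is injective.\<close>

lemma card_ind_transversals_fixed_le:
  assumes "finite S" "\<And>x. x \<in> S \<Longrightarrow> finite (V x)" "y \<in> S"
  shows "card {f \<in> ind_transversals V adj S. f y = b} \<le> card (ind_transversals V adj (S - {y}))"
proof (rule card_inj_on_le[where f = "\<lambda>f. restrict f (S - {y})"])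
  show "inj_on (\<lambda>f. restrict f (S - {y})) {f \<in> ind_transversals V adj S. f y = b}"
  proof (rule inj_onI)
    fix f g
    assume f: "f \<in> {f \<in> ind_transversals V adj S. f y = b}"
      and g: "g \<in> {f \<in> ind_transversals V adj S. f y = b}"
      and eq: "restrict f (S - {y}) = restrict g (S - {y})"
    have ext: "f \<in> extensional S" "g \<in> extensional S"
      using f g by (auto simp: ind_transversals_def PiE_def)
    show "f = g"
    proof (rule extensionalityI[OF ext])
      fix x assume "x \<in> S"
      then show "f x = g x"
        using f g fun_cong[OF eq, of x] by (cases "x = y") auto
    qed
  qed
  show "(\<lambda>f. restrict f (S - {y})) ` {f \<in> ind_transversals V adj S. f y = b}
      \<subseteq> ind_transversals V adj (S - {y})"
    by (auto simp: ind_transversals_def PiE_iff split: if_splits)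
  show "finite (ind_transversals V adj (S - {y}))"
    using assms by (intro finite_ind_transversals) auto
qed

text \<open>
  Rosenfeld's counting argument. An extension of an independent transversal \<open>f\<close> of \<open>S\<close> by \<open>x \<mapsto> a\<close> fails
  only if \<open>f\<close> passes through one of the at most \<open>\<Delta>\<close> neighbours \<open>(y, b)\<close> of \<open>(x, a)\<close>; by induction
  a fraction of at most \<open>1 / (2 \<Delta>)\<close> of all \<open>f\<close> passes through a given \<open>(y, b)\<close>, so at least half of
  all extensions succeed.
\<close>

lemma card_ind_transversals_insert:
  fixes V :: "'x \<Rightarrow> 'a set" and adj :: "'x \<Rightarrow> 'a \<Rightarrow> 'x \<Rightarrow> 'a \<Rightarrow> bool" and \<Delta> :: nat
  assumes finX: "finite X" and finV: "\<And>x. x \<in> X \<Longrightarrow> finite (V x)"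
    and sym: "\<And>x a y b. adj x a y b \<Longrightarrow> adj y b x a"
    and deg: "\<And>x a. x \<in> X \<Longrightarrow> a \<in> V x \<Longrightarrow>
      card {(y, b). y \<in> X \<and> y \<noteq> x \<and> b \<in> V y \<and> adj x a y b} \<le> \<Delta>"
    and big: "\<And>x. x \<in> X \<Longrightarrow> 4 * \<Delta> \<le> card (V x)"
    and "S \<subseteq> X" "x \<in> X" "x \<notin> S"
  shows "2 * \<Delta> * card (ind_transversals V adj S) \<le> card (ind_transversals V adj (insert x S))"
  using \<open>S \<subseteq> X\<close> \<open>x \<in> X\<close> \<open>x \<notin> S\<close>
proof (induction "card S" arbitrary: S x rule: less_induct)
  case less
  let ?T = "ind_transversals V adj"
  have finS: "finite S" using less.prems finX finite_subset by blast
  have finVS: "finite (V y)" if "y \<in> S" for y using that less.prems finV by auto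
  have finVx: "finite (V x)" using less.prems finV by auto
  have finT: "finite (?T S)" by (rule finite_ind_transversals[OF finS finVS])
  define N where "N = (\<lambda>a. {(y, b). y \<in> X \<and> y \<noteq> x \<and> b \<in> V y \<and> adj x a y b})"
  have finN: "finite (N a)" for a
    by (rule finite_subset[of _ "Sigma X V"]) (use finX finV in \<open>auto simp: N_def\<close>)
  \<comment> \<open>The pairs \<open>(f, a)\<close> for which some value of \<open>f\<close> on
    \<open>S\<close> is adjacent to \<open>(x, a)\<close>.\<close>
  define Bad where "Bad = (\<Union>a\<in>V x. \<Union>(y, b)\<in>{p \<in> N a. fst p \<in> S}. {f \<in> ?T S. f y = b} \<times> {a})"
  \<comment> \<open>Induction hypothesis for \<open>S - {y}\<close>, extended by
    \<open>y\<close>.\<close>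
  have fixed: "2 * \<Delta> * card {f \<in> ?T S. f y = b} \<le> card (?T S)" if "y \<in> S" for y b
  proof -
    have "2 * \<Delta> * card {f \<in> ?T S. f y = b} \<le> 2 * \<Delta> * card (?T (S - {y}))"
      by (intro mult_left_mono card_ind_transversals_fixed_le) (use that finS finVS in auto)
    also have "\<dots> \<le> card (?T (insert y (S - {y})))"
      by (rule less.hyps) (use that less.prems finS in \<open>auto intro: card_Diff1_less simp del: card_Diff_insert card_Diff_singleton\<close>)
    also have "insert y (S - {y}) = S" using that by auto
    finally show ?thesis .
  qed
  have "card Bad \<le> (\<Sum>a\<in>V x. \<Sum>(y, b)\<in>{p \<in> N a. fst p \<in> S}. card {f \<in> ?T S. f y = b})"
    unfolding Bad_def
    by (intro order_trans[OF card_UN_le[OF finVx]] sum_mono order_trans[OF card_UN_le])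
       (auto simp: finN card_cartesian_product case_prod_unfold)
  then have "2 * \<Delta> * card Bad \<le> 2 * \<Delta> * (\<Sum>a\<in>V x. \<Sum>(y, b)\<in>{p \<in> N a. fst p \<in> S}. card {f \<in> ?T S. f y = b})"
    by (rule mult_left_mono) simp
  also have "\<dots> = (\<Sum>a\<in>V x. \<Sum>(y, b)\<in>{p \<in> N a. fst p \<in> S}. 2 * \<Delta> * card {f \<in> ?T S. f y = b})"
    by (simp add: sum_distrib_left case_prod_unfold)
  also have "\<dots> \<le> (\<Sum>a\<in>V x. \<Sum>p\<in>{p \<in> N a. fst p \<in> S}. card (?T S))"
    by (intro sum_mono) (auto simp: case_prod_unfold fixed)
  also have "\<dots> \<le> (\<Sum>a\<in>V x. \<Delta> * card (?T S))"
  proof (rule sum_mono)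
    fix a assume "a \<in> V x"
    have "card {p \<in> N a. fst p \<in> S} \<le> card (N a)"
      by (rule card_mono[OF finN]) auto
    also have "\<dots> \<le> \<Delta>"
      unfolding N_def using deg[OF \<open>x \<in> X\<close> \<open>a \<in> V x\<close>] .
    finally show "(\<Sum>p\<in>{p \<in> N a. fst p \<in> S}. card (?T S)) \<le> \<Delta> * card (?T S)"
      by simp
  qed
  finally have "\<Delta> * (2 * card Bad) \<le> \<Delta> * (card (V x) * card (?T S))"
    by (simp add: mult_ac)
  \<comment> \<open>Cancelling \<Delta> leaves the case \<Delta> = 0 aside; there the claimed lower
    bound is 0.\<close>
  then have bad: "\<Delta> = 0 \<or> 2 * card Bad \<le> card (V x) * card (?T S)"
    by auto
  have finBad: "finite Bad"
    unfolding Bad_def using finVx finN finT by (auto simp: case_prod_unfold)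
  have "card (?T S \<times> V x - Bad) \<le> card (?T (insert x S))"
  proof (rule card_inj_on_le[where f = "\<lambda>(f, a). f(x := a)"])
    show "inj_on (\<lambda>(f, a). f(x := a)) (?T S \<times> V x - Bad)"
    proof (rule inj_onI, clarify)
      fix f a g b
      assume fg: "f \<in> ?T S" "g \<in> ?T S" and eq: "f(x := a) = g(x := b)"
      have ext: "f \<in> extensional S" "g \<in> extensional S"
        using fg by (auto simp: ind_transversals_def PiE_def)
      have "f y = g y" if "y \<in> S" for y
        using fun_cong[OF eq, of y] that less.prems by (auto split: if_splits)
      then have "f = g" by (rule extensionalityI[OF ext])
      moreover have "a = b" using fun_cong[OF eq, of x] by simp
      ultimately show "f = g \<and> a = b" by simp
    qed
    show "(\<lambda>(f, a). f(x := a)) ` (?T S \<times> V x - Bad) \<subseteq> ?T (insert x S)"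
    proof clarify
      fix f a assume f: "f \<in> ?T S" and a: "a \<in> V x" and nb: "(f, a) \<notin> Bad"
      have fV: "f \<in> Pi\<^sub>E S V" using f by (simp add: ind_transversals_def)
      have "\<not> adj x a y (f y)" if "y \<in> S" for y
      proof
        assume "adj x a y (f y)"
        then have "(y, f y) \<in> {p \<in> N a. fst p \<in> S}"
          using that less.prems fV by (auto simp: N_def)
        then have "(f, a) \<in> Bad" unfolding Bad_def using f a by fastforce
        then show False using nb by simp
      qed
      then show "f(x := a) \<in> ?T (insert x S)"
        using f a PiE_fun_upd[OF a fV] less.prems by (auto simp: ind_transversals_def dest: sym)
    qed
    show "finite (?T (insert x S))"
      using finS finVS finVx by (intro finite_ind_transversals) auto
  qed
  moreover have "card (?T S) * card (V x) - card Bad \<le> card (?T S \<times> V x - Bad)"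
    using diff_card_le_card_Diff[OF finBad, of "?T S \<times> V x"] by (simp add: card_cartesian_product)
  \<comment> \<open>At least half of the pairs survive, and \<open>big\<close> makes this half at
    least \<open>2 * \<Delta> * card (?T S)\<close>.\<close>
  moreover have "4 * \<Delta> * card (?T S) \<le> card (V x) * card (?T S)"
    using big[OF \<open>x \<in> X\<close>] by (rule mult_right_mono) simp
  ultimately show ?case
    using bad unfolding mult.commute[of "card (V x)"] by (elim disjE) (simp, linarith)
qed

text \<open>Adding the elements of \<open>X\<close> one by one to the single empty transversal
  multiplies the count by at least 2 \<Delta> > 0 each time.\<close>

lemma independent_transversal:
  fixes V :: "'x \<Rightarrow> 'a set" and adj :: "'x \<Rightarrow> 'a \<Rightarrow> 'x \<Rightarrow> 'a \<Rightarrow> bool" and \<Delta> :: nat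
  assumes finX: "finite X" and finV: "\<And>x. x \<in> X \<Longrightarrow> finite (V x)"
    and sym: "\<And>x a y b. adj x a y b \<Longrightarrow> adj y b x a"
    and deg: "\<And>x a. x \<in> X \<Longrightarrow> a \<in> V x \<Longrightarrow>
      card {(y, b). y \<in> X \<and> y \<noteq> x \<and> b \<in> V y \<and> adj x a y b} \<le> \<Delta>"
    and big: "\<And>x. x \<in> X \<Longrightarrow> 4 * \<Delta> \<le> card (V x)" and "\<Delta> > 0"
  obtains f where "\<And>x. x \<in> X \<Longrightarrow> f x \<in> V x"
    "\<And>x y. x \<in> X \<Longrightarrow> y \<in> X \<Longrightarrow> x \<noteq> y \<Longrightarrow> \<not> adj x (f x) y (f y)"
proof -
  have "card (ind_transversals V adj S) > 0" if "S \<subseteq> X" for S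
    using finite_subset[OF that finX] that
  proof (induction S rule: finite_induct)
    case empty
    have "ind_transversals V adj {} = {\<lambda>_. undefined}"
      by (auto simp: ind_transversals_def)
    then show ?case by simp
  next
    case (insert x S)
    have "2 * \<Delta> * card (ind_transversals V adj S) \<le> card (ind_transversals V adj (insert x S))"
      by (rule card_ind_transversals_insert[OF finX finV sym deg big]) (use insert in auto)
    moreover have "0 < 2 * \<Delta> * card (ind_transversals V adj S)"
      using insert \<open>\<Delta> > 0\<close> by simp
    ultimately show ?case by linarith
  qed
  then obtain f where "f \<in> ind_transversals V adj X"
    by (metis card_gt_0_iff ex_in_conv order_refl)
  then show thesis
    by (intro that[of f]) (auto simp: ind_transversals_def)
qed

section \<open>Bijections with few coincidences\<close>

lemma card_inj_PiE:
  assumes "finite U" "finite W" "card U = card W"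
  shows "card {f \<in> U \<rightarrow>\<^sub>E W. inj_on f U} = fact (card U)"
  using card_inj_on_subset_funcset[OF assms(1,2), of U] assms(3)
  by (simp add: fact_prod_rev)

text \<open>Fix the values on \<open>S\<close> point by point, with at most \<open>m\<close> options
  each; the factorial counts the rest. Domain and codomain are separate sets of equal size because
  the induction removes a point from \<open>U\<close> and its value from \<open>W\<close>.\<close>

lemma card_constrained_injections_le:
  fixes B :: "'a \<Rightarrow> 'b set"
  assumes "finite S" "finite U" "finite W" "card U = card W" "S \<subseteq> U"
    and "\<And>a. a \<in> S \<Longrightarrow> card (B a \<inter> W) \<le> m"
  shows "card {f \<in> U \<rightarrow>\<^sub>E W. inj_on f U \<and> (\<forall>a\<in>S. f a \<in> B a)}
    \<le> m ^ card S * fact (card U - card S)"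
  using assms
proof (induction S arbitrary: U W rule: finite_induct)
  case empty
  then show ?case by (simp add: card_inj_PiE)
next
  case (insert x S)
  let ?C = "\<lambda>U W S. {f \<in> U \<rightarrow>\<^sub>E W. inj_on f U \<and> (\<forall>a\<in>S. f a \<in> B a)}"
  have x: "x \<in> U" using insert.prems by auto
  have finC: "finite (?C U W S)" if "finite U" "finite W" for U W S
    by (rule finite_subset[of _ "U \<rightarrow>\<^sub>E W"]) (use that in \<open>auto intro: finite_PiE\<close>)
  have fibre: "card {f \<in> ?C U W (insert x S). f x = v} \<le> m ^ card S * fact (card U - card (insert x S))"
    if v: "v \<in> B x \<inter> W" for v
  proof -
    have "card {f \<in> ?C U W (insert x S). f x = v} \<le> card (?C (U - {x}) (W - {v}) S)"
    proof (rule card_inj_on_le[where f = "\<lambda>f. restrict f (U - {x})"])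
      show "inj_on (\<lambda>f. restrict f (U - {x})) {f \<in> ?C U W (insert x S). f x = v}"
      proof (rule inj_onI)
        fix f g
        assume f: "f \<in> {f \<in> ?C U W (insert x S). f x = v}"
          and g: "g \<in> {f \<in> ?C U W (insert x S). f x = v}"
          and eq: "restrict f (U - {x}) = restrict g (U - {x})"
        have ext: "f \<in> extensional U" "g \<in> extensional U"
          using f g by (auto simp: PiE_def)
        show "f = g"
        proof (rule extensionalityI[OF ext])
          fix y assume "y \<in> U"
          then show "f y = g y"
            using f g fun_cong[OF eq, of y] by (cases "y = x") auto
        qed
      qed
      show "(\<lambda>f. restrict f (U - {x})) ` {f \<in> ?C U W (insert x S). f x = v}
          \<subseteq> ?C (U - {x}) (W - {v}) S"
      proof clarify
        fix f assume f: "f \<in> U \<rightarrow>\<^sub>E W" "inj_on f U" "\<forall>a\<in>insert x S. f a \<in> B a" "v = f x"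
        have ne: "f y \<noteq> f x" if "y \<in> U - {x}" for y
          using that x inj_onD[OF f(2), of y x] by auto
        have "restrict f (U - {x}) \<in> (U - {x}) \<rightarrow>\<^sub>E (W - {f x})"
          using f(1) ne by (auto simp: PiE_iff)
        moreover have "inj_on (restrict f (U - {x})) (U - {x})"
          using f(2) by (auto simp: inj_on_def)
        moreover have "\<forall>a\<in>S. restrict f (U - {x}) a \<in> B a"
          using f(3) insert.hyps insert.prems by auto
        ultimately show "restrict f (U - {x}) \<in> (U - {x}) \<rightarrow>\<^sub>E (W - {f x}) \<and>
          inj_on (restrict f (U - {x})) (U - {x}) \<and> (\<forall>a\<in>S. restrict f (U - {x}) a \<in> B a)"
          by blast
      qed
      show "finite (?C (U - {x}) (W - {v}) S)"
        using insert.prems by (intro finC) auto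
    qed
    also have "\<dots> \<le> m ^ card S * fact (card (U - {x}) - card S)"
    proof (rule insert.IH)
      fix a assume "a \<in> S"
      have "card (B a \<inter> (W - {v})) \<le> card (B a \<inter> W)"
        using insert.prems by (intro card_mono) auto
      then show "card (B a \<inter> (W - {v})) \<le> m"
        using insert.prems(5)[of a] \<open>a \<in> S\<close> by simp
    qed (use insert.prems insert.hyps x v in \<open>auto simp: card_Diff_singleton\<close>)
    also have "card (U - {x}) - card S = card U - card (insert x S)"
      using insert x by (simp add: card_Diff_singleton)
    finally show ?thesis .
  qed
  have "?C U W (insert x S) = (\<Union>v\<in>B x \<inter> W. {f \<in> ?C U W (insert x S). f x = v})"
    using x by (auto simp: PiE_iff)
  then have "card (?C U W (insert x S)) = card (\<Union>v\<in>B x \<inter> W. {f \<in> ?C U W (insert x S). f x = v})"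
    by (rule arg_cong)
  also have "\<dots> \<le> (\<Sum>v\<in>B x \<inter> W. card {f \<in> ?C U W (insert x S). f x = v})"
    using insert.prems by (intro card_UN_le) auto
  also have "\<dots> \<le> (\<Sum>v\<in>B x \<inter> W. m ^ card S * fact (card U - card (insert x S)))"
    by (rule sum_mono) (rule fibre)
  also have "\<dots> \<le> m * (m ^ card S * fact (card U - card (insert x S)))"
    using insert.prems(5)[of x] by simp
  finally show ?case using insert.hyps by simp
qed

text \<open>Union bound over \<open>c\<close> and the r-subsets of \<open>U\<close>. With n = card
  U, at most m^r (n - r)! permutations satisfy \<open>R c\<close> on a given r-set, and there are n
  choose r such sets, so at most card I * m^r * n! / r! < n! permutations are bad.\<close>

lemma exists_bijection_few_coincidences:
  fixes R :: "'c \<Rightarrow> 'a \<Rightarrow> 'a \<Rightarrow> bool"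
  assumes finU: "finite U" and finI: "finite I"
    and deg: "\<And>c a. c \<in> I \<Longrightarrow> a \<in> U \<Longrightarrow> card {u \<in> U. R c a u} \<le> m"
    and small: "card I * m ^ r < fact r"
  obtains \<pi> where "bij_betw \<pi> U U" "\<And>c. c \<in> I \<Longrightarrow> card {a \<in> U. R c a (\<pi> a)} \<le> r"
proof (cases "r \<le> card U")
  case False
  show thesis
  proof (rule that[of id])
    show "card {a \<in> U. R c a (id a)} \<le> r" for c
      using card_mono[OF finU, of "{a \<in> U. R c a (id a)}"] False by simp
  qed simp
next
  case True
  let ?n = "card U"
  let ?P = "{f \<in> U \<rightarrow>\<^sub>E U. inj_on f U}"
  define Bad where "Bad = (\<lambda>c S. {f \<in> U \<rightarrow>\<^sub>E U. inj_on f U \<and> (\<forall>a\<in>S. f a \<in> {u \<in> U. R c a u})})"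
  define Sub where "Sub = {S. S \<subseteq> U \<and> card S = r}"
  have finSub: "finite Sub" unfolding Sub_def using finU by simp
  have cardSub: "card Sub = ?n choose r" unfolding Sub_def by (rule n_subsets[OF finU])
  have bad: "card (Bad c S) \<le> m ^ r * fact (?n - r)" if "c \<in> I" "S \<in> Sub" for c S
  proof -
    have S: "S \<subseteq> U" "card S = r" using that by (auto simp: Sub_def)
    show ?thesis unfolding Bad_def S(2)[symmetric]
    proof (rule card_constrained_injections_le)
      fix a assume "a \<in> S"
      have "{u \<in> U. R c a u} \<inter> U = {u \<in> U. R c a u}" by auto
      then show "card ({u \<in> U. R c a u} \<inter> U) \<le> m" using deg that \<open>a \<in> S\<close> S by auto
    qed (use S finU finite_subset in auto)
  qed
  have "card (\<Union>c\<in>I. \<Union>S\<in>Sub. Bad c S) \<le> (\<Sum>c\<in>I. \<Sum>S\<in>Sub. card (Bad c S))"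
    by (intro order_trans[OF card_UN_le[OF finI]] sum_mono card_UN_le[OF finSub])
  also have "\<dots> \<le> (\<Sum>c\<in>I. \<Sum>S\<in>Sub. m ^ r * fact (?n - r))"
    by (intro sum_mono bad)
  also have "\<dots> = card I * m ^ r * (fact (?n - r) * (?n choose r))"
    by (simp add: cardSub)
  also have "\<dots> < fact r * (fact (?n - r) * (?n choose r))"
    using small True by (intro mult_strict_right_mono) auto
  also have "\<dots> = fact ?n"
    using binomial_fact_lemma[OF True] by (simp add: mult.assoc)
  also have "\<dots> = card ?P"
    using card_inj_PiE[OF finU finU] by simp
  finally have lt: "card (\<Union>c\<in>I. \<Union>S\<in>Sub. Bad c S) < card ?P" .
  have "\<not> ?P \<subseteq> (\<Union>c\<in>I. \<Union>S\<in>Sub. Bad c S)"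
  proof
    assume "?P \<subseteq> (\<Union>c\<in>I. \<Union>S\<in>Sub. Bad c S)"
    moreover have "finite (\<Union>c\<in>I. \<Union>S\<in>Sub. Bad c S)"
      by (rule finite_subset[of _ "U \<rightarrow>\<^sub>E U"]) (use finU in \<open>auto simp: Bad_def intro: finite_PiE\<close>)
    ultimately have "card ?P \<le> card (\<Union>c\<in>I. \<Union>S\<in>Sub. Bad c S)"
      by (rule card_mono[rotated])
    then show False using lt by simp
  qed
  then obtain \<pi> where \<pi>: "\<pi> \<in> U \<rightarrow>\<^sub>E U" "inj_on \<pi> U"
    and good: "\<And>c S. c \<in> I \<Longrightarrow> S \<in> Sub \<Longrightarrow> \<pi> \<notin> Bad c S"
    by blast
  show thesis
  proof (rule that[of \<pi>])
    have "\<pi> ` U \<subseteq> U" using \<pi>(1) by auto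
    then show "bij_betw \<pi> U U"
      using \<pi>(2) endo_inj_surj[OF finU] by (simp add: bij_betw_def)
    show "card {a \<in> U. R c a (\<pi> a)} \<le> r" if "c \<in> I" for c
    proof (rule ccontr)
      assume "\<not> card {a \<in> U. R c a (\<pi> a)} \<le> r"
      then obtain S where "S \<subseteq> {a \<in> U. R c a (\<pi> a)}" "card S = r"
        by (meson linorder_not_le less_imp_le obtain_subset_with_card_n)
      then show False using good[OF that, of S] \<pi> by (auto simp: Sub_def Bad_def)
    qed
  qed
qed

text \<open>The quotient r^r / r! is a single term of the series for e^r, and e \<le> 3.\<close>

lemma power_self_le_3_power_mult_fact: "r ^ r \<le> 3 ^ r * (fact r :: nat)"
proof -
  have "(\<Sum>k\<in>{r}. real r ^ k /\<^sub>R fact k) \<le> (\<Sum>k. real r ^ k /\<^sub>R fact k)"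
    by (rule sum_le_suminf[OF summable_exp_generic]) auto
  then have "real r ^ r / fact r \<le> exp (real r)"
    by (simp add: exp_def field_simps)
  also have "\<dots> = exp 1 ^ r" by (simp add: exp_of_nat_mult[symmetric])
  also have "\<dots> \<le> 3 ^ r" using exp_le by (intro power_mono) auto
  finally have "real r ^ r \<le> 3 ^ r * fact r" by (simp add: field_simps)
  then have "real (r ^ r) \<le> real (3 ^ r * fact r)" by simp
  then show ?thesis by (simp only: of_nat_le_iff)
qed

section \<open>Sparse lines in the Boolean group\<close>

lemma xor_xor_cancel [simp]: "(a::nat) XOR (a XOR b) = b"
  by (simp flip: xor.assoc)

lemma xor_less_2_power:
  assumes "(a::nat) < 2 ^ t" "b < 2 ^ t"
  shows "a XOR b < 2 ^ t"
  using assms by (simp flip: take_bit_nat_eq_self_iff)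

definition sel :: "bool \<Rightarrow> nat \<Rightarrow> nat" where
  "sel e a = (if e then a else 0)"

lemma sel_simps [simp]: "sel True a = a" "sel False a = 0" "sel e 0 = 0"
  by (auto simp: sel_def)

text \<open>
  The relation \<open>F i j k v\<close> (symbol \<open>v\<close> is forbidden in cell \<open>(i, j, k)\<close>) is treated as a subset of
  \<open>G\<^sup>4\<close> with \<open>G = ({..<2 ^ t}, XOR)\<close>; a line in direction \<open>e\<close>, a 0-1 vector, is a coset of
  \<open>{a e | a \<in> G}\<close>.
\<close>

definition sparse_lines ::
  "nat \<Rightarrow> nat \<Rightarrow> (nat \<Rightarrow> nat \<Rightarrow> nat \<Rightarrow> nat \<Rightarrow> bool) \<Rightarrow> bool \<Rightarrow> bool \<Rightarrow> bool \<Rightarrow> bool \<Rightarrow> bool" where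
  "sparse_lines n r F e1 e2 e3 e4 \<longleftrightarrow>
     (\<forall>i<n. \<forall>j<n. \<forall>k<n. \<forall>v<n.
        card {a \<in> {..<n}. F (i XOR sel e1 a) (j XOR sel e2 a) (k XOR sel e3 a) (v XOR sel e4 a)} \<le> r)"

lemma card_xor_shift:
  assumes "(i::nat) < 2 ^ t"
  shows "card {a \<in> {..<2 ^ t}. P (i XOR a)} = card {a \<in> {..<2 ^ t}. P a}"
  by (rule bij_betw_same_card[of "(XOR) i"], rule bij_betw_byWitness[of _ "(XOR) i"])
     (use assms in \<open>auto intro: xor_less_2_power\<close>)

text \<open>A line whose direction has first coordinate \<open>True\<close> is parametrised by that
  coordinate, so its forbidden entries become coincidences of the permutation. There are 8 n^4 pairs
  of such a direction and a base point.\<close>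

lemma permute_first_coordinate:
  fixes F :: "nat \<Rightarrow> nat \<Rightarrow> nat \<Rightarrow> nat \<Rightarrow> bool"
  assumes n: "n = 2 ^ t"
    and deg: "\<And>j k v. j < n \<Longrightarrow> k < n \<Longrightarrow> v < n \<Longrightarrow> card {u \<in> {..<n}. F u j k v} \<le> m"
    and small: "8 * n ^ 4 * m ^ r < fact r"
  obtains \<pi> where "bij_betw \<pi> {..<n} {..<n}"
    "\<And>e2 e3 e4. sparse_lines n r (\<lambda>i. F (\<pi> i)) True e2 e3 e4"
proof -
  define I where "I = (UNIV :: (bool \<times> bool \<times> bool) set) \<times> {..<n} \<times> {..<n} \<times> {..<n} \<times> {..<n}"
  \<comment> \<open>Here \<open>b\<close> is the new first coordinate, \<open>u\<close> its image
    under the permutation, and \<open>i XOR b\<close> the parameter along the line.\<close>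
  define R where "R = (\<lambda>((e2, e3, e4), i, j, k, v) b u.
    F u (j XOR sel e2 (i XOR b)) (k XOR sel e3 (i XOR b)) (v XOR sel e4 (i XOR b)))"
  have sel_less: "x XOR sel e (i XOR b) < n" if "x < n" "i < n" "b < n" for x e i b
    using that unfolding n sel_def by (auto intro: xor_less_2_power)
  have "card I * m ^ r < fact r"
    using small by (simp add: I_def card_cartesian_product power4_eq_xxxx mult_ac flip: UNIV_Times_UNIV)
  then obtain \<pi> where \<pi>: "bij_betw \<pi> {..<n} {..<n}"
    and few: "\<And>c. c \<in> I \<Longrightarrow> card {a \<in> {..<n}. R c a (\<pi> a)} \<le> r"
  proof (rule exists_bijection_few_coincidences[of "{..<n}" I R m r, rotated 3])
    show "card {u \<in> {..<n}. R c a u} \<le> m" if "c \<in> I" "a \<in> {..<n}" for c a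
    proof -
      obtain e2 e3 e4 i j k v where "c = ((e2, e3, e4), i, j, k, v)"
        by (metis prod_cases3 surj_pair)
      moreover from this have "i < n" "j < n" "k < n" "v < n" "a < n" using that by (auto simp: I_def)
      ultimately show ?thesis
        using deg[OF sel_less sel_less sel_less, of j i a k i a v i a e2 e3 e4] by (simp add: R_def)
    qed
  qed (auto simp: I_def)
  have "sparse_lines n r (\<lambda>i. F (\<pi> i)) True e2 e3 e4" for e2 e3 e4
    unfolding sparse_lines_def
  proof (intro allI impI)
    fix i j k v assume lt: "i < n" "j < n" "k < n" "v < n"
    let ?c = "((e2, e3, e4), i, j, k, v)"
    have "card {a \<in> {..<n}. R ?c (i XOR a) (\<pi> (i XOR a))} \<le> r"
      using few[of ?c] lt card_xor_shift[of i t "\<lambda>b. R ?c b (\<pi> b)"] by (auto simp: I_def n)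
    then show "card {a \<in> {..<n}. F (\<pi> (i XOR sel True a)) (j XOR sel e2 a) (k XOR sel e3 a) (v XOR sel e4 a)} \<le> r"
      by (simp add: R_def)
  qed
  with \<pi> show thesis by (rule that)
qed

text \<open>Each permutation serves the directions whose last nonzero entry among the first three is
  its own coordinate. Later coordinates are constant on such lines, so permuting them only exchanges
  these lines. The direction (0, 0, 0, 1) is covered by \<open>deg4\<close> and
  \<open>m \<le> r\<close>.\<close>

lemma permute_to_sparse_lines:
  fixes F :: "nat \<Rightarrow> nat \<Rightarrow> nat \<Rightarrow> nat \<Rightarrow> bool"
  assumes n: "n = 2 ^ t"
    and deg1: "\<And>j k v. j < n \<Longrightarrow> k < n \<Longrightarrow> v < n \<Longrightarrow> card {u \<in> {..<n}. F u j k v} \<le> m"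
    and deg2: "\<And>i k v. i < n \<Longrightarrow> k < n \<Longrightarrow> v < n \<Longrightarrow> card {u \<in> {..<n}. F i u k v} \<le> m"
    and deg3: "\<And>i j v. i < n \<Longrightarrow> j < n \<Longrightarrow> v < n \<Longrightarrow> card {u \<in> {..<n}. F i j u v} \<le> m"
    and deg4: "\<And>i j k. i < n \<Longrightarrow> j < n \<Longrightarrow> k < n \<Longrightarrow> card {u \<in> {..<n}. F i j k u} \<le> m"
    and small: "8 * n ^ 4 * m ^ r < fact r" and "m \<le> r"
  obtains \<rho> \<sigma> \<tau> where "bij_betw \<rho> {..<n} {..<n}" "bij_betw \<sigma> {..<n} {..<n}" "bij_betw \<tau> {..<n} {..<n}"
    "\<And>e1 e2 e3 e4. e1 \<or> e2 \<or> e3 \<or> e4 \<Longrightarrow> sparse_lines n r (\<lambda>i j k. F (\<rho> i) (\<sigma> j) (\<tau> k)) e1 e2 e3 e4"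
proof -
  obtain \<rho> where \<rho>: "bij_betw \<rho> {..<n} {..<n}"
    and s\<rho>: "\<And>e2 e3 e4. sparse_lines n r (\<lambda>i. F (\<rho> i)) True e2 e3 e4"
    using permute_first_coordinate[OF n _ small, of F] deg1 by blast
  have \<rho>_less: "\<rho> i < n" if "i < n" for i using bij_betwE[OF \<rho>] that by auto
  obtain \<sigma> where \<sigma>: "bij_betw \<sigma> {..<n} {..<n}"
    and s\<sigma>: "\<And>e2 e3 e4. sparse_lines n r (\<lambda>j i. F (\<rho> i) (\<sigma> j)) True e2 e3 e4"
    using permute_first_coordinate[OF n _ small, of "\<lambda>j i. F (\<rho> i) j"] deg2 \<rho>_less by blast
  have \<sigma>_less: "\<sigma> j < n" if "j < n" for j using bij_betwE[OF \<sigma>] that by auto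
  obtain \<tau> where \<tau>: "bij_betw \<tau> {..<n} {..<n}"
    and s\<tau>: "\<And>e2 e3 e4. sparse_lines n r (\<lambda>k i j. F (\<rho> i) (\<sigma> j) (\<tau> k)) True e2 e3 e4"
    using permute_first_coordinate[OF n _ small, of "\<lambda>k i j. F (\<rho> i) (\<sigma> j) k"] deg3 \<rho>_less \<sigma>_less by blast
  have \<tau>_less: "\<tau> k < n" if "k < n" for k using bij_betwE[OF \<tau>] that by auto
  have "sparse_lines n r (\<lambda>i j k. F (\<rho> i) (\<sigma> j) (\<tau> k)) e1 e2 e3 e4" if "e1 \<or> e2 \<or> e3 \<or> e4" for e1 e2 e3 e4
  proof -
    consider "e3" | "\<not> e3" "e2" | "\<not> e3" "\<not> e2" "e1" | "\<not> e1" "\<not> e2" "\<not> e3" "e4"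
      using \<open>e1 \<or> e2 \<or> e3 \<or> e4\<close> by blast
    then show ?thesis
    proof cases
      case 1
      then show ?thesis using s\<tau>[of e1 e2 e4] by (simp add: sparse_lines_def)
    next
      case 2
      then show ?thesis using s\<sigma>[of e1 False e4] \<tau>_less by (simp add: sparse_lines_def)
    next
      case 3
      then show ?thesis using s\<rho>[of False False e4] \<tau>_less \<sigma>_less by (simp add: sparse_lines_def)
    next
      case 4
      have "card {a \<in> {..<n}. F (\<rho> i) (\<sigma> j) (\<tau> k) (v XOR a)} \<le> r"
        if "i < n" "j < n" "k < n" "v < n" for i j k v
        using card_xor_shift[of v t "\<lambda>a. F (\<rho> i) (\<sigma> j) (\<tau> k) a"] that
          deg4[of "\<rho> i" "\<sigma> j" "\<tau> k"] \<rho>_less \<sigma>_less \<tau>_less \<open>m \<le> r\<close> by (simp add: n)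
      then show ?thesis using 4 by (simp add: sparse_lines_def)
    qed
  qed
  with \<rho> \<sigma> \<tau> show thesis by (rule that)
qed

section \<open>Cells, moves along 0-1 directions and the Boolean Latin cube\<close>

type_synonym cell = "nat \<times> nat \<times> nat"

fun shift :: "bool \<times> bool \<times> bool \<Rightarrow> nat \<Rightarrow> cell \<Rightarrow> cell" where
  "shift (e1, e2, e3) a (i, j, k) = (i XOR sel e1 a, j XOR sel e2 a, k XOR sel e3 a)"

fun symb :: "cell \<Rightarrow> nat" where
  "symb (i, j, k) = i XOR j XOR k"

text \<open>The coordinate sum of \<open>e\<close> modulo 2: a move by \<open>a\<close> along
  \<open>e\<close> adds \<open>a\<close> to the symbol if it is odd and keeps the symbol
  otherwise.\<close>

fun par :: "bool \<times> bool \<times> bool \<Rightarrow> bool" where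
  "par (e1, e2, e3) \<longleftrightarrow> (e1 \<noteq> (e2 \<noteq> e3))"

abbreviation "zero_dir \<equiv> (False, False, False)"

lemma shift_shift_same [simp]: "shift e a (shift e a x) = x"
  by (cases e; cases x) (simp add: xor.assoc)

lemma shift_shift: "shift e a (shift e b x) = shift e (b XOR a) x"
  by (cases e; cases x) (simp add: sel_def xor.assoc)

text \<open>Moves by the same \<open>a\<close> add their directions modulo 2, so a subcube is closed
  under them.\<close>

lemma shift_add:
  "\<exists>g. shift e a (shift f a x) = shift g a x"
proof -
  obtain e1 e2 e3 f1 f2 f3 i j k where "e = (e1, e2, e3)" "f = (f1, f2, f3)" "x = (i, j, k)"
    by (metis prod_cases3)
  then have "shift e a (shift f a x) = shift (e1 \<noteq> f1, e2 \<noteq> f2, e3 \<noteq> f3) a x"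
    by (auto simp: sel_def xor.assoc)
  then show ?thesis by blast
qed

lemma shift_zero_dir [simp]: "shift zero_dir a x = x"
  by (cases x) simp

lemma symb_shift: "symb (shift e a x) = symb x XOR sel (par e) a"
  by (cases e; cases x) (auto simp: sel_def ac_simps)

lemma shift_in_cells:
  assumes "x \<in> {..<2 ^ t} \<times> {..<2 ^ t} \<times> {..<2 ^ t}" "a < 2 ^ t"
  shows "shift e a x \<in> {..<2 ^ t} \<times> {..<2 ^ t} \<times> {..<2 ^ t}"
  using assms by (cases e; cases x) (auto simp: sel_def intro: xor_less_2_power)

lemma symb_less:
  assumes "x \<in> {..<2 ^ t} \<times> {..<2 ^ t} \<times> {..<2 ^ t}"
  shows "symb x < 2 ^ t"
  using assms by (cases x) (auto intro: xor_less_2_power)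

section \<open>Swapping subcubes of the Boolean Latin cube\<close>

text \<open>
  A perturbation \<open>h\<close> of the symbols keeps lines injective as soon as \<open>h\<close> is constant along the moves
  \<open>x \<mapsto> shift e (h x) x\<close>: cells \<open>x\<close>, \<open>y\<close> on a line with equal new symbols move to a common cell.
\<close>

lemma latin_of_shift_invariant:
  assumes inv: "\<And>e x. x \<in> {..<2 ^ t} \<times> {..<2 ^ t} \<times> {..<2 ^ t} \<Longrightarrow> h (shift e (h x) x) = h x"
    and x: "x \<in> {..<2 ^ t} \<times> {..<2 ^ t} \<times> {..<2 ^ t}"
    and e: "par e" and y: "y = shift e d x" "d < 2 ^ t"
    and eq: "symb x XOR h x = symb y XOR h y"
  shows "y = x"
proof -
  have "symb x XOR (symb x XOR h x) = symb x XOR (symb y XOR h y)"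
    using eq by simp
  then have hx: "h x = d XOR h y"
    using e by (simp add: y(1) symb_shift xor.assoc)
  then have d: "d = h x XOR h y"
    by (simp add: xor.assoc)
  have "shift e (h y) y = shift e (h x) x"
    using hx by (simp add: y(1) shift_shift)
  moreover have "y \<in> {..<2 ^ t} \<times> {..<2 ^ t} \<times> {..<2 ^ t}"
    unfolding y(1) by (rule shift_in_cells[OF x y(2)])
  ultimately have "h y = h x" using inv[OF x, of e] inv[of y e] by metis
  then have "d = 0" using d by simp
  then show ?thesis unfolding y(1) by (cases e; cases x) simp
qed

text \<open>The constant is 211 = 15 + 4 * 49: at most 15 r directions are lost, and degree at most
  49 r requires 4 * 49 r remaining ones.\<close>

lemma exists_latin_avoiding_sparse:
  fixes F :: "nat \<Rightarrow> nat \<Rightarrow> nat \<Rightarrow> nat \<Rightarrow> bool"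
  assumes n: "n = 2 ^ t" and r: "0 < r" "211 * r \<le> n"
    and sparse: "\<And>e1 e2 e3 e4. e1 \<or> e2 \<or> e3 \<or> e4 \<Longrightarrow> sparse_lines n r F e1 e2 e3 e4"
  obtains L where "\<And>i j k. i < n \<Longrightarrow> j < n \<Longrightarrow> k < n \<Longrightarrow> L i j k < n \<and> \<not> F i j k (L i j k)"
    "\<And>i k. i < n \<Longrightarrow> k < n \<Longrightarrow> inj_on (\<lambda>j. L i j k) {..<n}"
    "\<And>j k. j < n \<Longrightarrow> k < n \<Longrightarrow> inj_on (\<lambda>i. L i j k) {..<n}"
    "\<And>i j. i < n \<Longrightarrow> j < n \<Longrightarrow> inj_on (\<lambda>k. L i j k) {..<n}"
proof -
  define cells where "cells = {..<n} \<times> {..<n} \<times> {..<n}"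
  define Fc where "Fc = (\<lambda>(i, j, k). F i j k)"
  define X where "X = {x \<in> cells. Fc x (symb x)}"
  define E where "E = (UNIV :: (bool \<times> bool \<times> bool) set) - {zero_dir}"
  \<comment> \<open>\<open>a \<in> V x\<close>: swapping the subcube at \<open>x\<close> in direction \<open>a\<close> creates no conflict, and \<open>x\<close> is its only
    conflict cell. The choice \<open>a = 0\<close> is excluded by \<open>e = zero_dir\<close>, since \<open>x\<close> is a conflict cell.\<close>
  define V where "V = (\<lambda>x. {a \<in> {..<n}. (\<forall>e. \<not> Fc (shift e a x) (symb x XOR sel (\<not> par e) a)) \<and>
    (\<forall>e\<in>E. shift e a x \<notin> X)})"
  define adj where "adj = (\<lambda>x a y b. \<exists>e f. shift e a x = shift f b y)"
  have finE: "finite E" by simp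
  have card_dirs: "card (UNIV :: (bool \<times> bool \<times> bool) set) = 8"
    by (simp add: card_cartesian_product flip: UNIV_Times_UNIV)
  have cardE: "card E = 7" by (simp add: E_def card_dirs)
  have shift_cells: "shift e a x \<in> cells" if "x \<in> cells" "a < n" for e a x
    using that shift_in_cells unfolding cells_def n by blast
  have symb_lt: "symb x < n" if "x \<in> cells" for x
    using that symb_less unfolding cells_def n by blast
  have finX: "finite X" by (rule finite_subset[of _ cells]) (auto simp: X_def cells_def)
  \<comment> \<open>The direction in G^4 is \<open>(e, c)\<close>; the last premise says that it is
    nonzero.\<close>
  have few: "card {a \<in> {..<n}. Fc (shift e a x) (v XOR sel c a)} \<le> r"
    if "x \<in> cells" "v < n" "e \<in> E \<or> c" for x v e c
  proof -
    obtain e1 e2 e3 i j k where e: "e = (e1, e2, e3)" and x: "x = (i, j, k)" by (metis prod_cases3)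
    have "e1 \<or> e2 \<or> e3 \<or> c" using that(3) by (auto simp: e E_def)
    from sparse[OF this] show ?thesis
      using that(1,2) by (simp add: sparse_lines_def Fc_def e x cells_def)
  qed
  have fewX: "card {a \<in> {..<n}. shift e a x \<in> X} \<le> r" if "x \<in> cells" "e \<in> E" for x e
  proof -
    have "{a \<in> {..<n}. shift e a x \<in> X} = {a \<in> {..<n}. Fc (shift e a x) (symb x XOR sel (par e) a)}"
      using that by (auto simp: X_def symb_shift shift_cells)
    then show ?thesis using few[OF that(1) symb_lt[OF that(1)], of e "par e"] that by simp
  qed
  have V_large: "196 * r \<le> card (V x)" if "x \<in> X" for x
  proof -
    have x: "x \<in> cells" using that by (simp add: X_def)
    \<comment> \<open>In \<open>B1\<close> even \<open>e = zero_dir\<close> gives a nonzero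
      direction, since the symbol then moves; hence eight sets here and seven in
      \<open>B2\<close>.\<close>
    define B1 where "B1 = (\<lambda>e. {a \<in> {..<n}. Fc (shift e a x) (symb x XOR sel (\<not> par e) a)})"
    define B2 where "B2 = (\<lambda>e. {a \<in> {..<n}. shift e a x \<in> X})"
    have "card (B1 e) \<le> r" for e
      unfolding B1_def by (rule few[OF x symb_lt[OF x]]) (auto simp: E_def)
    then have "(\<Sum>e\<in>UNIV. card (B1 e)) \<le> 8 * r"
      using sum_bounded_above[of UNIV "\<lambda>e. card (B1 e)" r] by (simp add: card_dirs)
    moreover have "(\<Sum>e\<in>E. card (B2 e)) \<le> 7 * r"
      using sum_bounded_above[of E "\<lambda>e. card (B2 e)" r] fewX[OF x] by (simp add: cardE B2_def)
    moreover have "card (\<Union>e. B1 e) \<le> (\<Sum>e\<in>UNIV. card (B1 e))" by (rule card_UN_le) simp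
    moreover have "card (\<Union>e\<in>E. B2 e) \<le> (\<Sum>e\<in>E. card (B2 e))" by (rule card_UN_le[OF finE])
    moreover have "card ((\<Union>e. B1 e) \<union> (\<Union>e\<in>E. B2 e)) \<le> card (\<Union>e. B1 e) + card (\<Union>e\<in>E. B2 e)"
      by (rule card_Un_le)
    ultimately have "card ((\<Union>e. B1 e) \<union> (\<Union>e\<in>E. B2 e)) \<le> 15 * r" by linarith
    moreover have "V x = {..<n} - ((\<Union>e. B1 e) \<union> (\<Union>e\<in>E. B2 e))"
      by (auto simp: V_def B1_def B2_def)
    moreover have "finite ((\<Union>e. B1 e) \<union> (\<Union>e\<in>E. B2 e))"
      by (rule finite_subset[of _ "{..<n}"]) (auto simp: B1_def B2_def)
    ultimately have "n - 15 * r \<le> card (V x)"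
      using diff_card_le_card_Diff[of "(\<Union>e. B1 e) \<union> (\<Union>e\<in>E. B2 e)" "{..<n}"] by simp
    then show ?thesis using r(2) by linarith
  qed
  have deg: "card {(y, b). y \<in> X \<and> y \<noteq> x \<and> b \<in> V y \<and> adj x a y b} \<le> 49 * r"
    if "x \<in> X" "a \<in> V x" for x a
  proof -
    have x: "x \<in> cells" and a: "a < n" using that by (auto simp: X_def V_def)
    \<comment> \<open>A neighbour \<open>(y, b)\<close> is reached from \<open>x\<close> by moving
      \<open>a\<close> along \<open>e\<close> and then \<open>b\<close> along \<open>f\<close>, so
      \<open>b\<close> determines \<open>y\<close> once \<open>e\<close> and \<open>f\<close> are
      fixed. There are 7 * 7 pairs of nonzero directions.\<close>
    define Q where "Q = (\<lambda>e f. (\<lambda>b. (shift f b (shift e a x), b)) ` {b \<in> {..<n}. shift f b (shift e a x) \<in> X})"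
    have finQ: "finite (Q e f)" for e f by (simp add: Q_def)
    have "{(y, b). y \<in> X \<and> y \<noteq> x \<and> b \<in> V y \<and> adj x a y b} \<subseteq> (\<Union>e\<in>E. \<Union>f\<in>E. Q e f)"
    proof clarify
      fix y b assume y: "y \<in> X" "y \<noteq> x" "b \<in> V y" "adj x a y b"
      then obtain e f where ef: "shift e a x = shift f b y" by (auto simp: adj_def)
      have yE: "shift f b (shift e a x) = y" by (simp add: ef)
      \<comment> \<open>For zero \<open>e\<close>, \<open>x\<close> would be a second conflict cell
        in the subcube of \<open>y\<close>; for zero \<open>f\<close>, \<open>y\<close> would be one
        in the subcube of \<open>x\<close>. Both contradict \<open>V\<close>.\<close>
      have "e \<in> E"
      proof (rule ccontr)
        assume "e \<notin> E"
        then have xy: "x = shift f b y" using ef by (simp add: E_def)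
        then have "f \<in> E" using y(2) by (auto simp: E_def)
        then show False using y(3) xy that(1) by (auto simp: V_def)
      qed
      moreover have "f \<in> E"
      proof (rule ccontr)
        assume "f \<notin> E"
        then have "shift e a x = y" using ef by (simp add: E_def)
        then show False using \<open>e \<in> E\<close> that(2) y(1) by (auto simp: V_def)
      qed
      moreover have "(y, b) \<in> Q e f"
        unfolding Q_def using y yE by (intro image_eqI[of _ _ b]) (auto simp: V_def)
      ultimately show "(y, b) \<in> (\<Union>e\<in>E. \<Union>f\<in>E. Q e f)" by blast
    qed
    then have "card {(y, b). y \<in> X \<and> y \<noteq> x \<and> b \<in> V y \<and> adj x a y b} \<le> card (\<Union>e\<in>E. \<Union>f\<in>E. Q e f)"
      by (rule card_mono[rotated]) (use finE finQ in auto)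
    also have "\<dots> \<le> (\<Sum>e\<in>E. \<Sum>f\<in>E. card (Q e f))"
      by (intro order_trans[OF card_UN_le[OF finE]] sum_mono card_UN_le[OF finE])
    also have "\<dots> \<le> (\<Sum>e\<in>E. \<Sum>f\<in>E. r)"
    proof (intro sum_mono)
      fix e f assume "e \<in> E" "f \<in> E"
      have "card (Q e f) \<le> card {b \<in> {..<n}. shift f b (shift e a x) \<in> X}"
        unfolding Q_def by (rule card_image_le) simp
      also have "\<dots> \<le> r" by (rule fewX[OF shift_cells[OF x a] \<open>f \<in> E\<close>])
      finally show "card (Q e f) \<le> r" .
    qed
    also have "\<dots> = 49 * r" by (simp add: cardE)
    finally show ?thesis .
  qed
  obtain f where fV: "\<And>x. x \<in> X \<Longrightarrow> f x \<in> V x"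
    and disj: "\<And>x y. x \<in> X \<Longrightarrow> y \<in> X \<Longrightarrow> x \<noteq> y \<Longrightarrow> \<not> adj x (f x) y (f y)"
  proof (rule independent_transversal[of X V adj "49 * r"])
    show "adj y b x a" if "adj x a y b" for x a y b
      using that unfolding adj_def by metis
  qed (use finX deg V_large r in \<open>auto simp: V_def\<close>)
  \<comment> \<open>The swap direction \<open>f y\<close> on the subcube of \<open>y\<close>, and 0
    off all subcubes. Disjointness makes the choice by \<open>SOME\<close> unique.\<close>
  define h where "h = (\<lambda>z. if \<exists>y\<in>X. \<exists>e. z = shift e (f y) y
    then f (SOME y. y \<in> X \<and> (\<exists>e. z = shift e (f y) y)) else 0)"
  have h_eq: "h (shift e (f y) y) = f y" if "y \<in> X" for e y
  proof -
    have ex: "\<exists>w\<in>X. \<exists>e'. shift e (f y) y = shift e' (f w) w" using that by blast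
    define w where "w = (SOME w. w \<in> X \<and> (\<exists>e'. shift e (f y) y = shift e' (f w) w))"
    have "w \<in> X \<and> (\<exists>e'. shift e (f y) y = shift e' (f w) w)"
      unfolding w_def by (rule someI_ex) (use that in blast)
    then have "w = y" using disj[OF that, of w] unfolding adj_def by blast
    then show ?thesis unfolding h_def if_P[OF ex] w_def by (rule arg_cong)
  qed
  have h_cases: "(\<exists>y\<in>X. \<exists>e. z = shift e (f y) y) \<or> z \<notin> X \<and> h z = 0" for z
  proof (cases "z \<in> X")
    case True
    then show ?thesis by (intro disjI1 bexI[of _ z] exI[of _ zero_dir]) simp_all
  qed (auto simp: h_def)
  have h_inv: "h (shift e (h z) z) = h z" for e z
    using h_cases[of z]
  proof
    assume "\<exists>y\<in>X. \<exists>e. z = shift e (f y) y"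
    then obtain y e' where y: "y \<in> X" "z = shift e' (f y) y" by blast
    obtain g where "shift e (f y) z = shift g (f y) y"
      unfolding y(2) using shift_add[of e "f y" e' y] by blast
    moreover have "h z = f y" unfolding y(2) by (rule h_eq[OF y(1)])
    ultimately show ?thesis by (simp only: h_eq[OF y(1)])
  next
    assume "z \<notin> X \<and> h z = 0"
    then have "shift e (h z) z = z" by (cases e; cases z) simp
    then show ?thesis by simp
  qed
  have h_less: "h z < n" for z
    using h_cases[of z] fV h_eq n by (auto simp: V_def)
  have avoid: "\<not> Fc z (symb z XOR h z)" if "z \<in> cells" for z
    using h_cases[of z]
  proof
    assume "\<exists>y\<in>X. \<exists>e. z = shift e (f y) y"
    then obtain y e where y: "y \<in> X" "z = shift e (f y) y" by blast
    \<comment> \<open>The position contributes \<open>f y\<close> if \<open>par e\<close>, and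
      \<open>h\<close> contributes it always; the two cancel when \<open>par e\<close>.\<close>
    have "symb z XOR h z = symb y XOR sel (\<not> par e) (f y)"
      by (simp add: y h_eq symb_shift xor.assoc) (simp add: sel_def)
    moreover have "\<not> Fc z (symb y XOR sel (\<not> par e) (f y))"
      unfolding y(2) using fV[OF y(1)] unfolding V_def by blast
    ultimately show ?thesis by simp
  next
    assume "z \<notin> X \<and> h z = 0"
    then show ?thesis using that by (simp add: X_def)
  qed
  have latin: "y = x" if "x \<in> cells" "par e" "y = shift e d x" "d < n" "symb x XOR h x = symb y XOR h y" for x y e d
    using latin_of_shift_invariant[of t h x e y d] h_inv that unfolding cells_def n by blast
  show thesis
  proof (rule that[of "\<lambda>i j k. symb (i, j, k) XOR h (i, j, k)"])
    fix i j k assume lt: "i < n" "j < n" "k < n"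
    then have c: "(i, j, k) \<in> cells" by (simp add: cells_def)
    show "symb (i, j, k) XOR h (i, j, k) < n \<and> \<not> F i j k (symb (i, j, k) XOR h (i, j, k))"
      using avoid[OF c] xor_less_2_power[of "symb (i, j, k)" t "h (i, j, k)"] symb_lt[OF c] h_less
      by (simp add: Fc_def n)
  next
    fix i k assume lt: "i < n" "k < n"
    show "inj_on (\<lambda>j. symb (i, j, k) XOR h (i, j, k)) {..<n}"
    proof (rule inj_onI)
      fix j j' assume "j \<in> {..<n}" "j' \<in> {..<n}"
        "symb (i, j, k) XOR h (i, j, k) = symb (i, j', k) XOR h (i, j', k)"
      then show "j = j'"
        using latin[of "(i, j, k)" "(False, True, False)" "(i, j', k)" "j XOR j'"] lt
        by (auto simp: cells_def n xor_less_2_power simp del: symb.simps)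
    qed
  next
    fix j k assume lt: "j < n" "k < n"
    show "inj_on (\<lambda>i. symb (i, j, k) XOR h (i, j, k)) {..<n}"
    proof (rule inj_onI)
      fix i i' assume "i \<in> {..<n}" "i' \<in> {..<n}"
        "symb (i, j, k) XOR h (i, j, k) = symb (i', j, k) XOR h (i', j, k)"
      then show "i = i'"
        using latin[of "(i, j, k)" "(True, False, False)" "(i', j, k)" "i XOR i'"] lt
        by (auto simp: cells_def n xor_less_2_power simp del: symb.simps)
    qed
  next
    fix i j assume lt: "i < n" "j < n"
    show "inj_on (\<lambda>k. symb (i, j, k) XOR h (i, j, k)) {..<n}"
    proof (rule inj_onI)
      fix k k' assume "k \<in> {..<n}" "k' \<in> {..<n}"
        "symb (i, j, k) XOR h (i, j, k) = symb (i, j, k') XOR h (i, j, k')"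
      then show "k = k'"
        using latin[of "(i, j, k)" "(False, False, True)" "(i, j, k')" "k XOR k'"] lt
        by (auto simp: cells_def n xor_less_2_power simp del: symb.simps)
    qed
  qed
qed

section \<open>The factorial estimate\<close>

text \<open>With r = 2^(t - 8), the bounds 6 m \<le> r and r^r \<le> 3^r r! give 2^r m^r \<le> r!,
  while 8 n^4 = 2^(4 t + 3) < 2^r.\<close>

lemma fact_dominates:
  assumes "t \<ge> 30" "6 * m \<le> 2 ^ (t - 8)"
  shows "8 * (2 ^ t) ^ 4 * m ^ (2 ^ (t - 8)) < (fact (2 ^ (t - 8)) :: nat)"
proof -
  let ?r = "2 ^ (t - 8) :: nat"
  \<comment> \<open>For s = t - 8, 4 s + 35 is 4 t + 3, and t \<ge> 30 becomes s \<ge> 22.\<close>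
  have exponent: "4 * s + 35 < 2 ^ s" if "s \<ge> 22" for s :: nat
    using that by (induction s rule: dec_induct) auto
  have "4 * t + 3 < ?r" using exponent[of "t - 8"] assms(1) by linarith
  have six: "(6::nat) ^ ?r = 3 ^ ?r * 2 ^ ?r" by (simp flip: power_mult_distrib)
  have "6 ^ ?r * m ^ ?r \<le> ?r ^ ?r"
    using power_mono[OF assms(2), of ?r] by (simp add: power_mult_distrib)
  also have "\<dots> \<le> 3 ^ ?r * fact ?r" by (rule power_self_le_3_power_mult_fact)
  finally have "3 ^ ?r * (2 ^ ?r * m ^ ?r) \<le> 3 ^ ?r * fact ?r"
    unfolding six mult.assoc .
  then have le: "2 ^ ?r * m ^ ?r \<le> fact ?r" by simp
  have "8 * (2 ^ t) ^ 4 = (2 ^ (4 * t + 3) :: nat)"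
    by (simp add: power_add mult.commute flip: power_mult)
  also have "\<dots> < 2 ^ ?r" using \<open>4 * t + 3 < ?r\<close> by (rule power_strict_increasing) simp
  finally have lt: "8 * (2 ^ t) ^ 4 < (2 ^ ?r :: nat)" .
  show ?thesis
  proof (cases "m = 0")
    case False
    then have "8 * (2 ^ t) ^ 4 * m ^ ?r < 2 ^ ?r * m ^ ?r"
      using lt by (intro mult_strict_right_mono) auto
    then show ?thesis using le by (rule less_le_trans)
  qed (simp add: zero_power)
qed

section \<open>Passage between indices from 0 and from 1, and assembly\<close>

lemma bij_betw_Suc_lessThan: "bij_betw Suc {..<n} {1..n}"
  by (simp add: bij_betw_def image_Suc_lessThan)

lemma bij_betw_Suc_conjugate:
  assumes "f ` {..<n} \<subseteq> {..<n}" "inj_on f {..<n}"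
  shows "bij_betw (\<lambda>i. Suc (f (i - 1))) {1..n} {1..n}"
proof -
  have "bij_betw (\<lambda>i. i - 1) {1..n} {..<n}"
    by (rule bij_betw_byWitness[of _ Suc]) auto
  moreover have "bij_betw f {..<n} {..<n}"
    using assms endo_inj_surj[of "{..<n}" f] by (simp add: bij_betw_def)
  ultimately have "bij_betw (Suc \<circ> (f \<circ> (\<lambda>i. i - 1))) {1..n} {1..n}"
    by (blast intro: bij_betw_trans bij_betw_Suc_lessThan)
  then show ?thesis by (simp add: comp_def)
qed

lemma card_Suc_shift: "card {j \<in> {1..n}. P j} = card {u \<in> {..<n}. P (Suc u)}"
proof -
  have "{j \<in> {1..n}. P j} = Suc ` {u \<in> {..<n}. P (Suc u)}"
    unfolding image_Suc_lessThan[symmetric] by blast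
  then show ?thesis by (simp add: card_image)
qed

lemma mcube_avoidable:
  assumes t: "t \<ge> 30" and m: "6 * m \<le> 2 ^ (t - 8)" and A: "mcube m (2 ^ t) A"
  shows "avoidable (2 ^ t) A"
proof -
  define n :: nat where "n = 2 ^ t"
  \<comment> \<open>This is n / 256, large enough for 6 m \<le> r and small enough for 211 r \<le>
    n.\<close>
  define r :: nat where "r = 2 ^ (t - 8)"
  have "n = 2 ^ 8 * r"
    unfolding n_def r_def by (subst power_add[symmetric]) (use t in simp)
  then have n_eq: "n = 256 * r" by simp
  define F where "F = (\<lambda>i j k v. Suc v \<in> A (Suc i) (Suc j) (Suc k))"
  have A_cell: "A i j k \<subseteq> {1..n}" "card (A i j k) \<le> m"
    and A_row: "s \<in> {1..n} \<Longrightarrow> card {j \<in> {1..n}. s \<in> A i j k} \<le> m"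
    and A_col: "s \<in> {1..n} \<Longrightarrow> card {i \<in> {1..n}. s \<in> A i j k} \<le> m"
    and A_file: "s \<in> {1..n} \<Longrightarrow> card {k \<in> {1..n}. s \<in> A i j k} \<le> m"
    if "i \<in> {1..n}" "j \<in> {1..n}" "k \<in> {1..n}" for i j k s
    using A that unfolding mcube_def n_def[symmetric] by blast+
  have cell: "card {u \<in> {..<n}. F i j k u} \<le> m" if "i < n" "j < n" "k < n" for i j k
  proof -
    have "A (Suc i) (Suc j) (Suc k) = {v \<in> {1..n}. v \<in> A (Suc i) (Suc j) (Suc k)}"
      using A_cell(1)[of "Suc i" "Suc j" "Suc k"] that by auto
    then show ?thesis
      using A_cell(2)[of "Suc i" "Suc j" "Suc k"] that
        card_Suc_shift[of n "\<lambda>v. v \<in> A (Suc i) (Suc j) (Suc k)"] by (simp add: F_def)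
  qed
  have small: "8 * n ^ 4 * m ^ r < fact r"
    unfolding n_def r_def by (rule fact_dominates[OF t m])
  obtain \<rho> \<sigma> \<tau> where perms: "bij_betw \<rho> {..<n} {..<n}" "bij_betw \<sigma> {..<n} {..<n}" "bij_betw \<tau> {..<n} {..<n}"
    and sparse: "\<And>e1 e2 e3 e4. e1 \<or> e2 \<or> e3 \<or> e4 \<Longrightarrow>
      sparse_lines n r (\<lambda>i j k. F (\<rho> i) (\<sigma> j) (\<tau> k)) e1 e2 e3 e4"
  proof (rule permute_to_sparse_lines[of n t F m r, OF n_def])
    \<comment> \<open>The index 1 fills the range premise of \<open>A_col\<close> for the coordinate
      that the counted set binds; similarly for rows and files below.\<close>
    show "card {u \<in> {..<n}. F u j k v} \<le> m" if "j < n" "k < n" "v < n" for j k v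
      using A_col[of 1 "Suc j" "Suc k" "Suc v"] that card_Suc_shift[of n "\<lambda>i. Suc v \<in> A i (Suc j) (Suc k)"] by (simp add: F_def)
    show "card {u \<in> {..<n}. F i u k v} \<le> m" if "i < n" "k < n" "v < n" for i k v
      using A_row[of "Suc i" 1 "Suc k" "Suc v"] that card_Suc_shift[of n "\<lambda>j. Suc v \<in> A (Suc i) j (Suc k)"] by (simp add: F_def)
    show "card {u \<in> {..<n}. F i j u v} \<le> m" if "i < n" "j < n" "v < n" for i j v
      using A_file[of "Suc i" "Suc j" 1 "Suc v"] that card_Suc_shift[of n "\<lambda>k. Suc v \<in> A (Suc i) (Suc j) k"] by (simp add: F_def)
    show "card {u \<in> {..<n}. F i j k u} \<le> m" if "i < n" "j < n" "k < n" for i j k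
      using that by (rule cell)
    show "8 * n ^ 4 * m ^ r < fact r" by (rule small)
    show "m \<le> r" using m by (simp add: r_def)
  qed (rule that)
  obtain L where L: "\<And>i j k. i < n \<Longrightarrow> j < n \<Longrightarrow> k < n \<Longrightarrow>
      L i j k < n \<and> \<not> F (\<rho> i) (\<sigma> j) (\<tau> k) (L i j k)"
    and inj: "\<And>i k. i < n \<Longrightarrow> k < n \<Longrightarrow> inj_on (\<lambda>j. L i j k) {..<n}"
    "\<And>j k. j < n \<Longrightarrow> k < n \<Longrightarrow> inj_on (\<lambda>i. L i j k) {..<n}"
    "\<And>i j. i < n \<Longrightarrow> j < n \<Longrightarrow> inj_on (\<lambda>k. L i j k) {..<n}"
  proof (rule exists_latin_avoiding_sparse[of n t r "\<lambda>i j k. F (\<rho> i) (\<sigma> j) (\<tau> k)", OF n_def])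
    show "0 < r" "211 * r \<le> n" by (simp_all add: n_eq r_def)
    show "sparse_lines n r (\<lambda>i j k. F (\<rho> i) (\<sigma> j) (\<tau> k)) e1 e2 e3 e4"
      if "e1 \<or> e2 \<or> e3 \<or> e4" for e1 e2 e3 e4
      using that by (rule sparse)
  qed (rule that)
  define inv_on :: "(nat \<Rightarrow> nat) \<Rightarrow> nat \<Rightarrow> nat" where "inv_on = inv_into {..<n}"
  have inv: "\<pi> (inv_on \<pi> i) = i" "inv_on \<pi> i < n"
    if "bij_betw \<pi> {..<n} {..<n}" "i < n" for \<pi> i
    using that bij_betw_inv_into_right[OF that(1)] bij_betwE[OF bij_betw_inv_into[OF that(1)]]
    by (auto simp: inv_on_def)
  have inj_comp: "inj_on (\<lambda>j. g (inv_on \<pi> j)) {..<n}"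
    if "bij_betw \<pi> {..<n} {..<n}" "inj_on g {..<n}" for \<pi> and g :: "nat \<Rightarrow> nat"
  proof (rule inj_onI)
    fix i j assume ij: "i \<in> {..<n}" "j \<in> {..<n}" "g (inv_on \<pi> i) = g (inv_on \<pi> j)"
    then have "inv_on \<pi> i = inv_on \<pi> j"
      using inj_onD[OF that(2), of "inv_on \<pi> i" "inv_on \<pi> j"] inv(2)[OF that(1)] by simp
    then show "i = j" using inv(1)[OF that(1)] ij(1,2) by (metis lessThan_iff)
  qed
  \<comment> \<open>Undoes the permutations: \<open>M\<close> at (\<rho> i, \<sigma> j, \<tau> k) is
    \<open>L\<close> at (i, j, k), so it avoids \<open>F\<close> itself.\<close>
  define M where "M = (\<lambda>i j k. L (inv_on \<rho> i) (inv_on \<sigma> j) (inv_on \<tau> k))"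
  have M: "M i j k < n" "\<not> F i j k (M i j k)" if "i < n" "j < n" "k < n" for i j k
    using L[of "inv_on \<rho> i" "inv_on \<sigma> j" "inv_on \<tau> k"] that
    by (simp_all add: M_def inv perms)
  have inj_row: "inj_on (\<lambda>j. M i j k) {..<n}" if "i < n" "k < n" for i k
    unfolding M_def
    by (intro inj_comp[of \<sigma> "\<lambda>j. L (inv_on \<rho> i) j (inv_on \<tau> k)"] inj inv perms that)
  have inj_col: "inj_on (\<lambda>i. M i j k) {..<n}" if "j < n" "k < n" for j k
    unfolding M_def
    by (intro inj_comp[of \<rho> "\<lambda>i. L i (inv_on \<sigma> j) (inv_on \<tau> k)"] inj inv perms that)
  have inj_file: "inj_on (\<lambda>k. M i j k) {..<n}" if "i < n" "j < n" for i j
    unfolding M_def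
    by (intro inj_comp[of \<tau> "L (inv_on \<rho> i) (inv_on \<sigma> j)"] inj inv perms that)
  define N where "N = (\<lambda>i j k. Suc (M (i - 1) (j - 1) (k - 1)))"
  have "latin_cube n N"
    unfolding latin_cube_def N_def
    by (intro conjI ballI bij_betw_Suc_conjugate inj_row inj_col inj_file) (auto intro!: M)
  moreover have "N i j k \<notin> A i j k" if "i \<in> {1..n}" "j \<in> {1..n}" "k \<in> {1..n}" for i j k
  proof -
    have "i - 1 < n" "j - 1 < n" "k - 1 < n" "0 < i" "0 < j" "0 < k" using that by auto
    then show ?thesis using M(2)[of "i - 1" "j - 1" "k - 1"] by (simp add: F_def N_def)
  qed
  ultimately show ?thesis unfolding avoidable_def n_def by blast
qed

theorem theorem1:
  "\<exists>\<gamma>::real. \<gamma> > 0 \<and>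
     (\<forall>t::nat. \<forall>m::nat. \<forall>A. t \<ge> 30 \<longrightarrow> real m \<le> \<gamma> * 2 ^ t \<longrightarrow>
        mcube m (2 ^ t) A \<longrightarrow> avoidable (2 ^ t) A)"
proof (intro exI[of _ "1 / 1536"] conjI allI impI)
  fix t m :: nat and A
  assume t: "t \<ge> 30" and m: "real m \<le> 1 / 1536 * 2 ^ t" and A: "mcube m (2 ^ t) A"
  \<comment> \<open>As 1536 = 6 * 2^8, the assumption on \<open>m\<close> amounts to 6 m \<le> 2^(t
    - 8).\<close>
  have "(2::real) ^ t = 2 ^ (t - 8) * 2 ^ 8"
    by (subst power_add[symmetric]) (use t in simp)
  then have "real (6 * m) \<le> real (2 ^ (t - 8))" using m by simp
  then have "6 * m \<le> 2 ^ (t - 8)" by (simp only: of_nat_le_iff)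
  then show "avoidable (2 ^ t) A" using mcube_avoidable t A by blast
qed simp

end
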